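(* Let $n\in\mathbb{N}$, let $0<\theta\le1$ and let $E$ be a Lebesgue measurable subset of $\mathbb{T}^n$ with $\lambda_n(E)\ge\theta$. Then for any polynomial $P\in\mathcal{P}(\mathbb{C}^n)$ with $\deg_\infty(P)=m$ and any $0<p<\infty$, $$\|P\|_{L^p(\mathbb{T}^n)}\le C(\theta)\,\Lambda(p,m)^n\,\big(\|P\|_{L^1(\mathbb{T}^n)}\big)^{1-\theta}\,\big(\|P\|_{L^1(E)}\big)^{\theta},$$ where $C(\theta)=\dfrac{1}{\theta^\theta(1-\theta)^{1-\theta}}\le2$ for every $0<\theta<1$, and $C(1)=1$.
   Context: $\mathcal{P}(\mathbb{C}^n)$ is the space of all polynomials $P(z)=\sum_\alpha c_\alpha(P)z^\alpha$ on $\mathbb{C}^n$ (finite sum over $\alpha\in\mathbb{N}_0^n$). $\deg_\infty(P)=\max_{1\le j\le n}\max\{\alpha_j : c_\alpha(P)\neq0\}$ is the maximal degree of $P$ in the individual variables (read as $0$ for the zero polynomial). $\mathbb{T}^n=\{z\in\mathbb{C}^n:|z_1|=\dots=|z_n|=1\}$ carries the normalized Lebesgue (Haar probability) measure $\lambda_n$, also written $dz$. For measurable $E$ with $\lambda_n(E)>0$ and $0<p<\infty$, $\|f\|_{L^p(E)}=\big(\int_E|f|^p\,d\lambda_n\big)^{1/p}$. For $0<p<\infty$ and $m\in\mathbb{N}_0$, $\Lambda(p,m)=\Big(\int_{\mathbb{T}}|1+z|^{mp}\,dz\Big)^{1/p}$. Convention: $0^0=1$. *)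

theory Defs
  imports "HOL-Probability.Probability" "HOL-Library.Poly_Mapping"
begin

text \<open>
  A polynomial on \<open>complex ^ 'n\<close> is its finitely supported coefficient family, indexed by the
  multi-indices \<open>nat ^ 'n\<close>. The number of variables is \<open>CARD('n)\<close>, which is always at least 1.
\<close>

type_synonym 'n cpoly = "(nat ^ 'n) \<Rightarrow>\<^sub>0 complex"

definition cpoly_eval :: "'n::finite cpoly \<Rightarrow> complex ^ 'n \<Rightarrow> complex" where
  "cpoly_eval P z = (\<Sum>\<alpha>\<in>Poly_Mapping.keys P. Poly_Mapping.lookup P \<alpha> * (\<Prod>j\<in>UNIV. (z $ j) ^ (\<alpha> $ j)))"

definition deg_infty :: "'n::finite cpoly \<Rightarrow> nat" where
  "deg_infty P = (if P = 0 then 0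
     else MAX j\<in>UNIV. Max {\<alpha> $ j |\<alpha>. Poly_Mapping.lookup P \<alpha> \<noteq> 0})"

definition torus :: "(complex ^ 'n::finite) set" where
  "torus = {z. \<forall>j. norm (z $ j) = 1}"

definition circle_measure :: "complex measure" where
  "circle_measure =
     distr (uniform_measure lborel {0..2 * pi}) (restrict_space borel (sphere 0 1)) cis"

text \<open>
  The \<open>CARD('n)\<close>-fold product of \<open>circle_measure\<close>, carried over from functions \<open>'n \<Rightarrow> complex\<close> to
  vectors by \<open>vec_lambda\<close>. The completion makes its measurable sets the Lebesgue measurable
  subsets of the torus, not just the Borel ones.
\<close>

definition torus_measure :: "(complex ^ 'n::finite) measure" where
  "torus_measure = completion
     (distr (PiM (UNIV :: 'n set) (\<lambda>_. circle_measure)) (restrict_space borel torus) vec_lambda)"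

definition Lp_norm :: "real \<Rightarrow> (complex ^ 'n::finite) set \<Rightarrow> (complex ^ 'n \<Rightarrow> complex) \<Rightarrow> real" where
  "Lp_norm p E f = (LINT z:E|torus_measure. norm (f z) powr p) powr (1 / p)"

text \<open>
  Real powers with \<open>0\<^sup>0 = 1\<close>; the library has \<open>0 powr 0 = 0\<close>.
\<close>

definition rpow :: "real \<Rightarrow> real \<Rightarrow> real" where
  "rpow x a = (if a = 0 then 1 else x powr a)"

definition Lam :: "real \<Rightarrow> nat \<Rightarrow> real" where
  "Lam p m = (LINT z|circle_measure. rpow (norm (1 + z)) (real m * p)) powr (1 / p)"

definition C_const :: "real \<Rightarrow> real" where
  "C_const \<theta> = 1 / (rpow \<theta> \<theta> * rpow (1 - \<theta>) (1 - \<theta>))"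

end

theory Submission
  imports Defs "HOL-Complex_Analysis.Cauchy_Integral_Formula"
    "HOL-Computational_Algebra.Fundamental_Theorem_Algebra"
begin

text \<open>
  On the circle a polynomial of degree at most \<open>m\<close> has modulus \<open>c \<Prod>\<^sub>j |1 - a\<^sub>j z|\<close> with \<open>m\<close> factors and
  \<open>|a\<^sub>j| \<le> 1\<close>. The product has no zeros in the open disk, so its \<open>s\<close>-th power is holomorphic there and
  \<open>c\<close> is at most its \<open>L\<^sup>s\<close> norm for every \<open>s > 0\<close>. The AM-GM inequality and the subharmonicity of
  \<open>a \<mapsto> |1 - a z|\<^sup>q\<close> bound its \<open>L\<^sup>p\<close> norm by \<open>\<Lambda>(p,m) c\<close>. Minkowski's integral inequality transports
  this comparison of the \<open>L\<^sup>p\<close> and \<open>L\<^sup>s\<close> norms to the torus, one variable at a time, with constant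
  \<open>\<Lambda>(p,m)\<^sup>n\<close> independent of \<open>s \<le> p\<close>. On \<open>E\<close> and on its complement \<open>|P|\<^sup>s\<close> lies below suitable tangents
  to the concave function \<open>x\<^sup>s\<close>; letting \<open>s \<longrightarrow> 0\<close> and optimizing the two points of tangency gives
  the claim.
\<close>

section \<open>Integration over the circle\<close>

lemma measurable_cis [measurable]:
  "cis \<in> uniform_measure lborel {0..2 * pi} \<rightarrow>\<^sub>M restrict_space borel (sphere 0 1)"
proof (rule measurable_restrict_space2)
  show "cis \<in> borel_measurable (uniform_measure lborel {0..2 * pi})"
    using borel_measurable_continuous_onI[of cis] continuous_on_cis[OF continuous_on_id]
    by (simp add: id_def)
qed auto

lemma prob_space_circle: "prob_space circle_measure"
proof -
  interpret prob_space "uniform_measure lborel {0..2 * pi}"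
    by (rule prob_space_uniform_measure) (auto simp: emeasure_lborel_Icc_eq)
  show ?thesis
    unfolding circle_measure_def by (rule prob_space_distr) (rule measurable_cis)
qed

lemma space_circle [simp]: "space circle_measure = sphere 0 1"
  and sets_circle [measurable_cong, simp]: "sets circle_measure = sets (restrict_space borel (sphere 0 1))"
  unfolding circle_measure_def by (simp_all add: space_restrict_space)

lemma circle_measurable_continuous:
  fixes f :: "complex \<Rightarrow> 'b::topological_space"
  assumes "continuous_on (sphere 0 1) f"
  shows "f \<in> borel_measurable circle_measure"
  using borel_measurable_continuous_on_restrict[OF assms]
  by (simp cong: measurable_cong_sets)

lemma circle_integrable:
  fixes f :: "complex \<Rightarrow> 'b::euclidean_space"
  assumes "continuous_on (sphere 0 1) f"
  shows "integrable circle_measure f"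
proof -
  interpret prob_space circle_measure by (rule prob_space_circle)
  have "bounded (f ` sphere 0 1)"
    by (intro compact_imp_bounded compact_continuous_image assms) auto
  then obtain B where "\<And>z. z \<in> sphere 0 1 \<Longrightarrow> norm (f z) \<le> B"
    unfolding bounded_iff by blast
  then show ?thesis
    by (intro integrable_const_bound[of _ B] AE_I2 circle_measurable_continuous assms) auto
qed

text \<open>Passes from the measure on the circle to the gauge integral over one period, where
  contour integrals and shifts of the interval are at hand.\<close>

lemma circle_has_integral:
  fixes f :: "complex \<Rightarrow> 'b::euclidean_space"
  assumes f: "continuous_on (sphere 0 1) f"
  shows "((\<lambda>t. f (cis t)) has_integral (2 * pi) *\<^sub>R (LINT z|circle_measure. f z)) {0..2 * pi}"
proof -
  have cont: "continuous_on S (\<lambda>t. f (cis t))" for S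
    by (rule continuous_on_compose2[OF f]) (auto intro!: continuous_intros)
  have u: "uniform_measure lborel {0..2 * pi}
      = density lborel (\<lambda>x. ennreal (indicator {0..2 * pi} x / (2 * pi)))"
    unfolding uniform_measure_def
    by (intro density_cong) (auto simp: emeasure_lborel_Icc_eq divide_ennreal[symmetric] indicator_def
        intro!: AE_I2)
  have "(LINT z|circle_measure. f z) = (LINT t|uniform_measure lborel {0..2 * pi}. f (cis t))"
    unfolding circle_measure_def
    using f measurable_cis by (subst integral_distr) (auto intro: borel_measurable_continuous_on_restrict)
  also have "\<dots> = (LINT t|lborel. (indicator {0..2 * pi} t / (2 * pi)) *\<^sub>R f (cis t))"
    unfolding u using cont[of UNIV]
    by (intro integral_density) (auto intro!: borel_measurable_continuous_onI)
  also have "\<dots> = (1 / (2 * pi)) *\<^sub>R (LINT t:{0..2 * pi}|lborel. f (cis t))"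
    unfolding set_lebesgue_integral_def by (simp flip: integral_scaleR_right add: mult.commute)
  finally have "(2 * pi) *\<^sub>R (LINT z|circle_measure. f z) = (LINT t:{0..2 * pi}|lborel. f (cis t))"
    by simp
  moreover have "set_integrable lborel {0..2 * pi} (\<lambda>t. f (cis t))"
    unfolding set_integrable_def using borel_integrable_compact[OF _ cont]
    by (simp add: indicator_scaleR_eq_if)
  ultimately show ?thesis
    using set_borel_integral_eq_integral[of "{0..2 * pi}" "\<lambda>t. f (cis t)"]
    by (metis has_integral_integrable_integral)
qed

text \<open>With \<open>w = cis c\<close>, a rotation shifts the parameter interval by
  \<open>c\<close>. The piece beyond \<open>2 * pi\<close> is carried back to the interval from 0 to
  \<open>c\<close> by periodicity.\<close>

lemma circle_integral_rotate:
  fixes f :: "complex \<Rightarrow> 'b::euclidean_space"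
  assumes f: "continuous_on (sphere 0 1) f" and w: "norm w = 1"
  shows "(LINT z|circle_measure. f (w * z)) = (LINT z|circle_measure. f z)"
proof -
  obtain c where c: "0 \<le> c" "c < 2 * pi" and wc: "w = cis c"
    using w by (metis Arg2pi_ge_0 Arg2pi_lt_2pi complex_norm_eq_1_exp cis_conv_exp)
  have cont: "continuous_on S (\<lambda>t. f (cis t))" for S
    by (rule continuous_on_compose2[OF f]) (auto intro!: continuous_intros)
  have "continuous_on (sphere 0 1) (\<lambda>z. f (w * z))"
    by (rule continuous_on_compose2[OF f]) (auto intro!: continuous_intros simp: w norm_mult)
  from circle_has_integral[OF this]
  have I: "((\<lambda>t. f (cis (t + c))) has_integral (2 * pi) *\<^sub>R (LINT z|circle_measure. f (w * z))) {0..2 * pi}"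
    by (simp add: wc cis_mult add.commute)
  define g where "g t = f (cis t)" for t
  have gper: "g (t + 2 * pi) = g t" for t
    by (simp add: g_def cis.ctr)
  have gi: "g integrable_on {a..b}" for a b
    using cont unfolding g_def by (intro integrable_continuous_interval)
  have sh: "integral {a + d..b + d} g = integral {a..b} (\<lambda>t. g (t + d))" for a b d
    using integral_shift_Icc_real[of a b g d] by (simp add: o_def add.commute)
  have "(2 * pi) *\<^sub>R (LINT z|circle_measure. f (w * z)) = integral {0..2 * pi} (\<lambda>t. g (t + c))"
    using I by (simp add: g_def integral_unique)
  also have "\<dots> = integral {c..2 * pi + c} g"
    using sh[of 0 c "2 * pi"] by simp
  also have "\<dots> = integral {c..2 * pi} g + integral {2 * pi..2 * pi + c} g"
    using c by (intro Henstock_Kurzweil_Integration.integral_combine[symmetric] gi) auto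
  also have "integral {2 * pi..2 * pi + c} g = integral {0..c} g"
    using sh[of 0 "2 * pi" c] gper by (simp add: add.commute)
  also have "integral {c..2 * pi} g + integral {0..c} g = integral {0..2 * pi} g"
    using c by (subst add.commute, intro Henstock_Kurzweil_Integration.integral_combine gi) auto
  also have "\<dots> = (2 * pi) *\<^sub>R (LINT z|circle_measure. f z)"
    using circle_has_integral[OF f] by (simp add: g_def[abs_def] integral_unique)
  finally show ?thesis by simp
qed

text \<open>Cauchy's formula at \<open>a\<close>, applied to \<open>H\<close> times a holomorphic
  factor that equals 1 at \<open>a\<close> and produces the Poisson kernel on the circle. Mere
  continuity up to the boundary is assumed because powers of \<open>1 - a * w\<close> with
  \<open>norm a = 1\<close> fail to be holomorphic at one boundary point.\<close>

lemma Poisson_formula: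
  assumes H: "continuous_on (cball 0 1) H" "H holomorphic_on ball 0 1" and a: "norm a < 1"
  shows "(LINT w|circle_measure. H w * of_real ((1 - (norm a)\<^sup>2) / (norm (w - a))\<^sup>2)) = H a"
proof -
  have nz: "1 - cnj a * w \<noteq> 0" if "norm w \<le> 1" for w
  proof
    assume "1 - cnj a * w = 0"
    then have "norm (cnj a * w) = 1" by (metis eq_iff_diff_eq_0 norm_one)
    moreover have "norm (cnj a * w) < 1"
      using that a mult_left_mono[of "norm w" 1 "norm a"] by (simp add: norm_mult)
    ultimately show False by simp
  qed
  \<comment> \<open>On the circle \<open>1 - cnj a * w = w * cnj (w - a)\<close>. Hence dividing
    \<open>G\<close> by \<open>w - a\<close> leaves \<open>H\<close> times the kernel, divided by
    \<open>w\<close>, and the velocity \<open>\<i> * w\<close> of the path cancels that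
    \<open>w\<close>.\<close>
  define G where "G w = H w * of_real (1 - (norm a)\<^sup>2) / (1 - cnj a * w)" for w
  have nza: "cis t \<noteq> a" for t using a by auto
  have G1: "continuous_on (cball 0 1) G"
    unfolding G_def by (intro continuous_intros H) (use nz in auto)
  have G2: "G holomorphic_on ball 0 1"
    unfolding G_def by (intro holomorphic_intros H) (use nz in auto)
  have Ga: "G a = H a"
  proof -
    have "complex_of_real (1 - (norm a)\<^sup>2) = 1 - cnj a * a"
      by (simp only: of_real_diff complex_norm_square of_real_1 mult.commute)
    then show ?thesis using nz[of a] a unfolding G_def by simp
  qed
  have eq: "G w / (w - a) * (\<i> * w) = \<i> * (H w * of_real ((1 - (norm a)\<^sup>2) / (norm (w - a))\<^sup>2))"
    if "norm w = 1" for w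
  proof -
    have w: "w * cnj w = 1" using that by (metis complex_norm_square of_real_1 one_power2)
    have "w \<noteq> a" using that a by auto
    then have d: "w - a \<noteq> 0" "cnj (w - a) \<noteq> 0" by auto
    have e: "1 - cnj a * w = w * cnj (w - a)"
      using w by (simp add: algebra_simps)
    have "w \<noteq> 0" using that by auto
    have N: "complex_of_real ((norm (w - a))\<^sup>2) = (w - a) * cnj (w - a)"
      by (simp only: complex_norm_square)
    \<comment> \<open>Stated for free variables, so that \<open>field_simps\<close> treats
      \<open>w - a\<close> and its conjugate as atoms.\<close>
    have alg: "h * K / (w * d') / d * (\<i> * w) = \<i> * (h * (K / (d * d')))"
      if "d \<noteq> 0" "d' \<noteq> 0" for h K d d' :: complex
      using that \<open>w \<noteq> 0\<close> by (simp add: field_simps)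
    show ?thesis
      unfolding G_def e of_real_divide N by (rule alg[OF d])
  qed
  let ?k = "\<lambda>w. H w * of_real ((1 - (norm a)\<^sup>2) / (norm (w - a))\<^sup>2)"
  have k: "continuous_on (sphere 0 1) ?k"
    using a by (intro continuous_intros continuous_on_subset[OF H(1)]) auto
  have "((\<lambda>u. G u / (u - a)) has_contour_integral (2 * of_real pi * \<i> * G a)) (circlepath 0 1)"
    using Cauchy_integral_circlepath[OF G1 G2] a by simp
  then have "((\<lambda>t. G (cis t) / (cis t - a) * (\<i> * cis t)) has_integral (2 * of_real pi * \<i> * H a)) {0..2 * pi}"
    unfolding circlepath_def
    by (subst (asm) has_contour_integral_part_circlepath_iff) (auto simp: Ga mult_ac)
  then have "((\<lambda>t. \<i> * ?k (cis t)) has_integral (2 * of_real pi * \<i> * H a)) {0..2 * pi}"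
    by (rule has_integral_eq[rotated]) (rule eq, simp)
  moreover have "((\<lambda>t. \<i> * ?k (cis t)) has_integral \<i> * ((2 * pi) *\<^sub>R (LINT z|circle_measure. ?k z))) {0..2 * pi}"
    by (intro has_integral_mult_right circle_has_integral k)
  ultimately have "2 * of_real pi * \<i> * H a = \<i> * ((2 * pi) *\<^sub>R (LINT z|circle_measure. ?k z))"
    by (rule has_integral_unique)
  then show ?thesis by (simp add: scaleR_conv_of_real)
qed

section \<open>Polynomials in one variable\<close>

lemma measurable_circle_ident [measurable]: "(\<lambda>z. z) \<in> borel_measurable circle_measure"
  by (intro circle_measurable_continuous continuous_intros)

text \<open>Keeps \<open>1 - a * w\<close> in the closed right half-plane, where the principal power
  with a positive exponent is continuous, even at the origin.\<close>

lemma Re_one_minus_mult: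
  assumes "norm a \<le> 1" "norm w \<le> 1"
  shows "Re (1 - a * w) \<ge> 0"
proof -
  have "norm a * norm w \<le> 1 * 1" using assms by (intro mult_mono) auto
  then show ?thesis
    using complex_Re_le_cmod[of "a * w"] by (simp add: norm_mult)
qed

lemma continuous_on_one_minus_powr:
  fixes a :: complex
  assumes "norm a \<le> 1" "0 < s"
  shows "continuous_on (cball 0 1) (\<lambda>w. (1 - a * w) powr of_real s)"
  using Re_one_minus_mult[of a] assms
  by (intro continuous_intros) (auto simp: subset_iff)

lemma holomorphic_on_one_minus_powr:
  fixes a :: complex
  assumes "norm a \<le> 1"
  shows "(\<lambda>w. (1 - a * w) powr of_real s) holomorphic_on ball 0 1"
proof (intro holomorphic_intros)
  fix w :: complex assume "w \<in> ball 0 1"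
  then have "norm a * norm w \<le> 1 * norm w" "norm w < 1"
    using assms by (intro mult_right_mono, auto)[1] (use \<open>w \<in> ball 0 1\<close> in simp)
  then have "Re (1 - a * w) > 0"
    using complex_Re_le_cmod[of "a * w"] by (simp add: norm_mult)
  then show "1 - a * w \<notin> \<real>\<^sub>\<le>\<^sub>0"
    by (auto simp: complex_nonpos_Reals_iff)
qed

lemma powr_prod: "(\<And>i. i \<in> I \<Longrightarrow> 0 \<le> f i) \<Longrightarrow> (\<Prod>i\<in>I. f i) powr s = (\<Prod>i\<in>I. (f i :: real) powr s)"
  by (induction I rule: infinite_finite_induct) (auto simp: powr_mult prod_nonneg)

text \<open>The zero-free product \<open>\<Prod>(1 - a\<^sub>j w)\<close> has a holomorphic \<open>s\<close>-th power, whose value at \<open>0\<close> is its mean.\<close>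

lemma circle_mean_prod_ge_1:
  fixes a :: "nat \<Rightarrow> complex"
  assumes a: "\<And>j. norm (a j) \<le> 1" and s: "0 < s"
  shows "1 \<le> (LINT w|circle_measure. (\<Prod>j<m. norm (1 - a j * w)) powr s)"
proof -
  define H where "H w = (\<Prod>j<m. (1 - a j * w) powr of_real s)" for w
  have cont: "continuous_on (cball 0 1) H"
    unfolding H_def by (intro continuous_on_prod continuous_on_one_minus_powr a s)
  have hol: "H holomorphic_on ball 0 1"
    unfolding H_def by (intro holomorphic_on_prod holomorphic_on_one_minus_powr a)
  \<comment> \<open>At the centre the Poisson kernel is 1 on the circle, and the formula becomes the
    mean value property.\<close>
  have "(LINT w|circle_measure. H w) = (LINT w|circle_measure. H w * of_real ((1 - (norm (0::complex))\<^sup>2) / (norm (w - 0))\<^sup>2))"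
    by (intro Bochner_Integration.integral_cong) auto
  also have "\<dots> = H 0"
    by (rule Poisson_formula[OF cont hol]) simp
  also have "H 0 = 1" by (simp add: H_def)
  finally have "1 = norm (LINT w|circle_measure. H w)" by simp
  also have "\<dots> \<le> (LINT w|circle_measure. norm (H w))"
    by (rule integral_norm_bound)
  also have "\<dots> = (LINT w|circle_measure. (\<Prod>j<m. norm (1 - a j * w)) powr s)"
    by (simp add: H_def powr_prod prod_norm[symmetric] norm_powr_real_powr')
  finally show ?thesis .
qed

text \<open>For \<open>norm a = 1\<close> rotation gives equality. Otherwise, for fixed
  \<open>z\<close>, the value at \<open>a\<close> is bounded by the Poisson average of the values at
  boundary points \<open>w\<close>. After Fubini each \<open>w\<close> contributes the same integral
  by rotation, and the kernel has total mass 1.\<close>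

lemma circle_mean_one_minus_le:
  assumes a: "norm a \<le> 1" and q: "0 < q"
  shows "(LINT z|circle_measure. norm (1 - a * z) powr q) \<le> (LINT z|circle_measure. norm (1 + z) powr q)"
proof -
  have cont: "continuous_on (sphere 0 1) (\<lambda>z. norm (1 + z) powr q)"
    using q by (intro continuous_intros continuous_on_powr') auto
  have rot: "(LINT z|circle_measure. norm (1 - w * z) powr q) = (LINT z|circle_measure. norm (1 + z) powr q)"
    if "norm w = 1" for w
    using circle_integral_rotate[OF cont, of "- w"] that by simp
  show ?thesis
  proof (cases "norm a = 1")
    case True
    then show ?thesis using rot[of a] by simp
  next
    case False
    then have a1: "norm a < 1" using a by simp
    interpret prob_space circle_measure by (rule prob_space_circle)
    interpret pair_prob_space circle_measure circle_measure ..
    define k where "k w = (1 - (norm a)\<^sup>2) / (norm (w - a))\<^sup>2" for w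
    have k0: "0 \<le> k w" for w
      unfolding k_def using a1 by (simp add: abs_square_le_1 power_le_one)
    have kcont: "continuous_on (sphere 0 1) k"
      unfolding k_def using a1 by (intro continuous_intros) auto
    have kint: "(LINT w|circle_measure. k w) = 1"
      using Poisson_formula[of "\<lambda>_. 1" a] a1
      by (simp add: k_def del: of_real_divide of_real_diff of_real_power)
    \<comment> \<open>The bound on the kernel, uniform in \<open>w\<close>, makes the double
      integrand bounded, as Fubini requires.\<close>
    have k_bound: "k w \<le> (1 - (norm a)\<^sup>2) / (1 - norm a)\<^sup>2" if "norm w = 1" for w
    proof -
      have "1 - norm a \<le> norm (w - a)" using norm_triangle_ineq2[of w a] that by simp
      then show ?thesis
        unfolding k_def using a1 by (intro divide_left_mono power_mono mult_pos_pos zero_less_power) (auto simp: abs_square_le_1 power_le_one)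
    qed
    have km [measurable]: "k \<in> borel_measurable borel"
      unfolding k_def by measurable
    define g where "g z w = norm (1 - w * z) powr q * k w" for z w
    have g_int: "integrable (circle_measure \<Otimes>\<^sub>M circle_measure) (case_prod g)"
    proof (rule P.integrable_const_bound)
      show "case_prod g \<in> borel_measurable (circle_measure \<Otimes>\<^sub>M circle_measure)"
        unfolding g_def by measurable
      show "AE x in circle_measure \<Otimes>\<^sub>M circle_measure. norm (case_prod g x) \<le> 2 powr q * ((1 - (norm a)\<^sup>2) / (1 - norm a)\<^sup>2)"
      proof (rule AE_I2)
        fix x assume "x \<in> space (circle_measure \<Otimes>\<^sub>M circle_measure)"
        then obtain z w where x: "x = (z, w)" "norm z = 1" "norm w = 1"
          by (auto simp: space_pair_measure)
        have "norm (1 - w * z) \<le> 2" using norm_triangle_ineq4[of 1 "w * z"] x by (simp add: norm_mult)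
        then show "norm (case_prod g x) \<le> 2 powr q * ((1 - (norm a)\<^sup>2) / (1 - norm a)\<^sup>2)"
          unfolding x(1) using k_bound[OF x(3)] k0[of w] q
          unfolding g_def prod.case real_norm_def abs_mult
            using \<open>norm (1 - w * z) \<le> 2\<close> by (intro mult_mono) (auto intro: powr_mono2)
      qed
    qed
    have bound: "norm (1 - a * z) powr q \<le> (LINT w|circle_measure. g z w)" if "z \<in> space circle_measure" for z
    proof -
      have z: "norm z \<le> 1" using that by simp
      have "norm (1 - a * z) powr q = norm ((1 - z * a) powr of_real q)"
        by (simp add: norm_powr_real_powr' mult.commute)
      \<comment> \<open>Here \<open>z\<close> is the fixed coefficient and \<open>a\<close> is the
        interior point: the holomorphic function is the power of \<open>1 - z * w\<close> in the
        variable \<open>w\<close>.\<close>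
      also have "(1 - z * a) powr of_real q = (LINT w|circle_measure. (1 - z * w) powr of_real q * of_real (k w))"
        unfolding k_def using a1
        by (intro Poisson_formula[symmetric] continuous_on_one_minus_powr holomorphic_on_one_minus_powr z q)
      also have "norm \<dots> \<le> (LINT w|circle_measure. norm ((1 - z * w) powr of_real q * of_real (k w)))"
        by (rule integral_norm_bound)
      also have "\<dots> = (LINT w|circle_measure. g z w)"
        using k0 by (simp add: g_def norm_mult norm_powr_real_powr' mult.commute)
      finally show ?thesis .
    qed
    have "(LINT z|circle_measure. norm (1 - a * z) powr q) \<le> (LINT z|circle_measure. (LINT w|circle_measure. g z w))"
    proof (rule integral_mono[OF circle_integrable _ bound])
      show "continuous_on (sphere 0 1) (\<lambda>z. norm (1 - a * z) powr q)"
        using q by (intro continuous_intros continuous_on_powr') auto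
      show "integrable circle_measure (\<lambda>z. LINT w|circle_measure. g z w)"
        using integrable_fst[OF g_int] .
    qed
    also have "\<dots> = (LINT w|circle_measure. (LINT z|circle_measure. g z w))"
      by (rule Fubini_integral[OF g_int, symmetric])
    also have "\<dots> = (LINT w|circle_measure. (LINT z|circle_measure. norm (1 + z) powr q) * k w)"
      by (intro Bochner_Integration.integral_cong refl) (auto simp: g_def rot)
    also have "\<dots> = (LINT z|circle_measure. norm (1 + z) powr q)"
      by (simp add: kint)
    finally show ?thesis .
  qed
qed

text \<open>Zeros outside the disk are reflected, and factors with \<open>a\<^sub>j = 0\<close> pad the product to length \<open>m\<close>.\<close>

lemma poly_norm_on_circle:
  fixes p :: "complex poly"
  assumes "degree p \<le> m"
  obtains c :: real and a :: "nat \<Rightarrow> complex"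
  where "0 \<le> c" "\<And>j. norm (a j) \<le> 1"
    "\<And>z. norm z = 1 \<Longrightarrow> norm (poly p z) = c * (\<Prod>j<m. norm (1 - a j * z))"
proof -
  have "\<exists>c a. 0 \<le> c \<and> (\<forall>j. norm (a j) \<le> 1) \<and>
      (\<forall>z. norm z = 1 \<longrightarrow> norm (poly p z) = c * (\<Prod>j<m. norm (1 - a j * z)))"
    if "degree p \<le> m" for p :: "complex poly"
    using that
  proof (induction m arbitrary: p)
    case 0
    then obtain c where "p = [:c:]" by (auto elim: degree_eq_zeroE)
    then show ?case
      by (intro exI[of _ "norm c"] exI[of _ "\<lambda>_. 0"]) auto
  next
    case (Suc m)
    have "\<exists>q b d. degree q \<le> m \<and> norm b \<le> 1 \<and> 0 \<le> d \<and>
        (\<forall>z. norm z = 1 \<longrightarrow> norm (poly p z) = norm (poly q z) * (d * norm (1 - b * z)))"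
    proof (cases "degree p \<le> m")
      case True
      then show ?thesis
        by (intro exI[of _ p] exI[of _ 0] exI[of _ 1]) auto
    next
      case False
      then obtain r where "poly p r = 0"
        using alg_closed_imp_poly_has_root[of p] by auto
      then obtain q where q: "p = [:- r, 1:] * q" by (meson dvdE poly_eq_0_iff_dvd)
      have "q \<noteq> 0" using q False by auto
      then have dq: "degree q \<le> m" using Suc.prems unfolding q by (subst (asm) degree_mult_eq) auto
      have pz: "norm (poly p z) = norm (poly q z) * norm (z - r)" for z
        unfolding q poly_mult norm_mult by (simp add: mult.commute)
      show ?thesis
      \<comment> \<open>If \<open>norm r \<le> 1\<close>, the factor \<open>z - r\<close> has the
        same modulus on the circle as \<open>1 - cnj r * z\<close>, which moves a nonzero root
        \<open>r\<close> to \<open>1 / cnj r\<close>. If \<open>norm r > 1\<close>, the root stays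
        where it is and only the scalar \<open>norm r\<close> is taken out.\<close>
      proof (cases "norm r \<le> 1")
        case True
        have "norm (z - r) = norm (1 - cnj r * z)" if "norm z = 1" for z
        proof -
          have "z * cnj z = 1" using that by (metis complex_norm_square of_real_1 one_power2)
          then have "z * cnj (1 - cnj r * z) = z - r" by (simp add: algebra_simps)
          then show ?thesis using that by (metis complex_mod_cnj mult_1 norm_mult)
        qed
        then show ?thesis
          using True dq pz by (intro exI[of _ q] exI[of _ "cnj r"] exI[of _ 1]) auto
      next
        case False
        then have "norm (z - r) = norm r * norm (1 - (1 / r) * z)" for z
          by (subst norm_mult[symmetric], subst norm_minus_commute) (auto simp: algebra_simps)
        then show ?thesis
          using False dq pz by (intro exI[of _ q] exI[of _ "1 / r"] exI[of _ "norm r"]) (auto simp: norm_divide divide_le_eq_1)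
      qed
    qed
    then obtain q b d where q: "degree q \<le> m" "norm b \<le> 1" "0 \<le> d"
      "\<And>z. norm z = 1 \<Longrightarrow> norm (poly p z) = norm (poly q z) * (d * norm (1 - b * z))"
      by blast
    from Suc.IH[OF q(1)] obtain c a where "0 \<le> c" "\<And>j. norm (a j) \<le> 1"
      "\<And>z. norm z = 1 \<Longrightarrow> norm (poly q z) = c * (\<Prod>j<m. norm (1 - a j * z))" by blast
    with q show ?case
      by (intro exI[of _ "c * d"] exI[of _ "a(m := b)"]) (auto simp: algebra_simps)
  qed
  from this[OF assms] show ?thesis using that by blast
qed

text \<open>Both norms are compared with the factor \<open>c\<close> of the product representation:
  AM-GM bounds the left one by \<open>Lam p m * c\<close>, and the mean of the zero-free product
  shows that \<open>c\<close> is at most the norm with exponent \<open>s\<close>.\<close>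

lemma poly_circle_Lp_le:
  fixes P :: "complex poly"
  assumes deg: "degree P \<le> m" and p: "0 < p" and s: "0 < s"
  shows "(LINT z|circle_measure. norm (poly P z) powr p) powr (1 / p)
     \<le> Lam p m * (LINT z|circle_measure. norm (poly P z) powr s) powr (1 / s)"
proof -
  interpret prob_space circle_measure by (rule prob_space_circle)
  obtain c a where c: "0 \<le> c" and a: "\<And>j. norm (a j) \<le> 1"
    and P: "\<And>z. norm z = 1 \<Longrightarrow> norm (poly P z) = c * (\<Prod>j<m. norm (1 - a j * z))"
    using poly_norm_on_circle[OF deg] by metis
  let ?Q = "\<lambda>z. \<Prod>j<m. norm (1 - a j * z)"
  have Q0: "0 \<le> ?Q z" for z by (intro prod_nonneg) auto
  have int_P: "(LINT z|circle_measure. norm (poly P z) powr q) = c powr q * (LINT z|circle_measure. ?Q z powr q)" for q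
  proof -
    have "(LINT z|circle_measure. norm (poly P z) powr q) = (LINT z|circle_measure. c powr q * ?Q z powr q)"
      using c by (intro Bochner_Integration.integral_cong refl) (auto simp: P powr_mult Q0)
    then show ?thesis by simp
  qed
  have L: "(LINT z|circle_measure. ?Q z powr p) \<le> (LINT z|circle_measure. rpow (norm (1 + z)) (real m * p))"
  proof (cases "m = 0")
    \<comment> \<open>For \<open>m = 0\<close> the empty product and \<open>rpow\<close> with
      exponent 0 are both 1.\<close>
    case True
    then show ?thesis by (simp add: rpow_def)
  next
    case False
    then have mp: "0 < real m * p" using p by simp
    \<comment> \<open>\<open>?Q z powr p\<close> is the geometric mean of the \<open>m\<close>
      numbers \<open>norm (1 - a j * z) powr (real m * p)\<close>, whence the exponent in
      \<open>Lam\<close>.\<close>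
    have "(LINT z|circle_measure. ?Q z powr p) \<le> (LINT z|circle_measure. (\<Sum>j<m. norm (1 - a j * z) powr (real m * p) / real m))"
    proof (rule integral_mono)
      show "integrable circle_measure (\<lambda>z. ?Q z powr p)"
        using p Q0 by (intro circle_integrable continuous_intros continuous_on_powr') auto
      show "integrable circle_measure (\<lambda>z. \<Sum>j<m. norm (1 - a j * z) powr (real m * p) / real m)"
        using mp False by (intro circle_integrable continuous_intros continuous_on_powr') auto
      fix z
      show "?Q z powr p \<le> (\<Sum>j<m. norm (1 - a j * z) powr (real m * p) / real m)"
        using arith_geom_mean[of "{..<m}" "\<lambda>j. norm (1 - a j * z) powr (real m * p)"] False
        by (simp add: lessThan_empty_iff powr_prod[symmetric] powr_powr)
    qed
    also have "\<dots> = (\<Sum>j<m. (LINT z|circle_measure. norm (1 - a j * z) powr (real m * p) / real m))"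
      using mp False by (intro Bochner_Integration.integral_sum circle_integrable continuous_intros continuous_on_powr') auto
    also have "\<dots> \<le> (\<Sum>j<m. (LINT z|circle_measure. norm (1 + z) powr (real m * p)) / real m)"
      using circle_mean_one_minus_le[OF a mp] by (intro sum_mono) (simp add: divide_right_mono)
    also have "\<dots> = (LINT z|circle_measure. rpow (norm (1 + z)) (real m * p))"
      using False p by (simp add: rpow_def)
    finally show ?thesis .
  qed
  have "(LINT z|circle_measure. norm (poly P z) powr p) powr (1 / p)
      \<le> (c powr p * (LINT z|circle_measure. rpow (norm (1 + z)) (real m * p))) powr (1 / p)"
    unfolding int_P using p L by (intro powr_mono2 mult_left_mono mult_nonneg_nonneg) auto
  also have "\<dots> = Lam p m * c"
    using p c by (subst powr_mult) (auto simp: Lam_def powr_powr)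
  also have "c = (c powr s) powr (1 / s)"
    using s c by (simp add: powr_powr)
  also have "\<dots> \<le> (LINT z|circle_measure. norm (poly P z) powr s) powr (1 / s)"
    unfolding int_P using s c circle_mean_prod_ge_1[where a = a and m = m, OF a s]
    by (intro powr_mono2) (auto simp: mult_le_cancel_left1)
  finally show ?thesis
    by (auto simp: Lam_def mult_left_mono)
qed

section \<open>Minkowski's inequality and products\<close>

text \<open>The left side is the weighted geometric mean of \<open>c powr (1 - r) * u powr r\<close>
  and \<open>c * v powr r\<close>, in which the powers of \<open>c\<close> cancel. The scale
  \<open>c\<close> stays free so that it can be fitted to each slice in Minkowski's
  inequality.\<close>

lemma young_scaled:
  fixes u v c r :: real
  assumes "0 \<le> u" "0 \<le> v" "0 < c" "1 \<le> r"
  shows "u * v powr (r - 1) \<le> c powr (1 - r) * u powr r / r + (1 - 1 / r) * c * v powr r"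
proof (cases "u = 0 \<or> v = 0")
  case True
  moreover have "0 \<le> (1 - 1 / r) * c * v powr r" using assms by simp
  ultimately show ?thesis using assms by auto
next
  case False
  then have uv: "0 < u" "0 < v" using assms by auto
  have "u * v powr (r - 1) = (c powr (1 - r) * u powr r) powr (1 / r) * (c * v powr r) powr (1 - 1 / r)"
  proof -
    have "(c powr (1 - r) * u powr r) powr (1 / r) = c powr (1 / r - 1) * u"
      using assms uv by (simp add: powr_mult powr_powr diff_divide_distrib)
    moreover have "(c * v powr r) powr (1 - 1 / r) = c powr (1 - 1 / r) * v powr (r - 1)"
      using assms uv by (simp add: powr_mult powr_powr right_diff_distrib)
    moreover have "c powr (1 / r - 1) * c powr (1 - 1 / r) = 1"
      using assms by (simp flip: powr_add)
    ultimately show ?thesis by (metis (no_types, opaque_lifting) mult.assoc mult.commute mult_1)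
  qed
  also have "\<dots> \<le> 1 / r * (c powr (1 - r) * u powr r) + (1 - 1 / r) * (c * v powr r)"
    using assms uv by (intro Youngs_inequality_0) auto
  finally show ?thesis by (simp add: mult.assoc)
qed

text \<open>With \<open>H\<close> the inner integral, one factor of \<open>H powr r\<close> is
  written as an integral of \<open>g\<close> and the order of integration is exchanged. Scaled Young
  bounds each slice, and positivity of \<open>n\<close> makes the scale \<open>n y / N\<close>
  admissible.\<close>

lemma minkowski_integral_pos:
  fixes g :: "'a \<Rightarrow> 'b \<Rightarrow> real" and n :: "'b \<Rightarrow> real"
  assumes M1: "prob_space M1" and M2: "prob_space M2" and r: "1 \<le> r"
    and g[measurable]: "case_prod g \<in> borel_measurable (M1 \<Otimes>\<^sub>M M2)"
    and g_bd: "\<And>x y. x \<in> space M1 \<Longrightarrow> y \<in> space M2 \<Longrightarrow> 0 \<le> g x y \<and> g x y \<le> B"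
    and n: "integrable M2 n" and n_pos: "\<And>y. y \<in> space M2 \<Longrightarrow> 0 < n y"
    and le: "\<And>y. y \<in> space M2 \<Longrightarrow> (LINT x|M1. g x y powr r) \<le> n y powr r"
  shows "(LINT x|M1. (LINT y|M2. g x y) powr r) \<le> (LINT y|M2. n y) powr r"
proof -
  interpret A: prob_space M1 by (rule M1)
  interpret B: prob_space M2 by (rule M2)
  interpret P: pair_prob_space M1 M2 ..
  define N where "N = (LINT y|M2. n y)"
  have N: "0 < N"
    unfolding N_def using n n_pos B.integral_less_AE_space[of "\<lambda>_. 0" n] B.emeasure_space_1 by simp
  define H where "H x = (LINT y|M2. g x y)" for x
  have B: "0 \<le> B"
    using g_bd A.not_empty B.not_empty by (metis all_not_in_conv order_trans)
  have gx[measurable]: "(\<lambda>y. g x y) \<in> borel_measurable M2" if "x \<in> space M1" for x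
    using that by measurable
  have gy[measurable]: "(\<lambda>x. g x y) \<in> borel_measurable M1" if "y \<in> space M2" for y
    using that by measurable
  have H[measurable]: "H \<in> borel_measurable M1"
    unfolding H_def by measurable
  have gi: "integrable M2 (g x)" if "x \<in> space M1" for x
    using that g_bd by (intro B.integrable_const_bound[of _ B]) auto
  have H_bd: "0 \<le> H x \<and> H x \<le> B" if "x \<in> space M1" for x
  proof
    show "0 \<le> H x" unfolding H_def using that g_bd by (intro Bochner_Integration.integral_nonneg) auto
    have "H x \<le> (LINT y|M2. B)" unfolding H_def using that g_bd by (intro integral_mono gi) auto
    then show "H x \<le> B" by (simp add: B.prob_space)
  qed
  have Hp_bd: "H x powr q \<le> B powr q" if "x \<in> space M1" "0 \<le> q" for x q
    using H_bd[OF that(1)] that(2) by (intro powr_mono2) auto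
  define J where "J = (LINT x|M1. H x powr r)"
  have HrI: "integrable M1 (\<lambda>x. H x powr r)"
    using Hp_bd r by (intro A.integrable_const_bound[of _ "B powr r"]) auto
  have gH_bd: "norm (g x y * H x powr (r - 1)) \<le> B * B powr (r - 1)" if "x \<in> space M1" "y \<in> space M2" for x y
    using that g_bd[OF that] Hp_bd[of x "r - 1"] r B by (auto simp: abs_mult intro!: mult_mono)
  have gHI: "integrable (M1 \<Otimes>\<^sub>M M2) (case_prod (\<lambda>x y. g x y * H x powr (r - 1)))"
    using gH_bd by (intro P.P.integrable_const_bound[of _ "B * B powr (r - 1)"])
      (auto simp: space_pair_measure intro!: AE_I2)
  have "J = (LINT x|M1. (LINT y|M2. g x y * H x powr (r - 1)))"
    unfolding J_def
  proof (intro Bochner_Integration.integral_cong refl)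
    fix x assume x: "x \<in> space M1"
    have "(LINT y|M2. g x y * H x powr (r - 1)) = H x * H x powr (r - 1)"
      unfolding H_def by simp
    also have "\<dots> = H x powr r"
      using H_bd[OF x] by (cases "H x = 0") (auto simp: powr_mult_base)
    finally show "H x powr r = (LINT y|M2. g x y * H x powr (r - 1))" by simp
  qed
  also have "\<dots> = (LINT y|M2. (LINT x|M1. g x y * H x powr (r - 1)))"
    by (rule P.Fubini_integral[OF gHI, symmetric])
  also have "\<dots> \<le> (LINT y|M2. n y / N * (N powr r / r + (1 - 1 / r) * J))"
  proof (rule integral_mono)
    show "integrable M2 (\<lambda>y. LINT x|M1. g x y * H x powr (r - 1))"
      using P.integrable_snd[OF gHI] .
    show "integrable M2 (\<lambda>y. n y / N * (N powr r / r + (1 - 1 / r) * J))"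
      using n by auto
    fix y assume y: "y \<in> space M2"
    \<comment> \<open>This choice turns \<open>c powr (1 - r) * n y powr r\<close> into
      \<open>c * N powr r\<close>. Both Young terms are then proportional to \<open>n y\<close>, and
      the ratios \<open>n y / N\<close> integrate to 1.\<close>
    define c where "c = n y / N"
    have c: "0 < c" using n_pos[OF y] N by (simp add: c_def)
    have grI: "integrable M1 (\<lambda>x. g x y powr r)"
      using y g_bd r by (intro A.integrable_const_bound[of _ "B powr r"]) (auto intro!: AE_I2 powr_mono2)
    have "(LINT x|M1. g x y * H x powr (r - 1))
        \<le> (LINT x|M1. c powr (1 - r) * g x y powr r / r + (1 - 1 / r) * c * H x powr r)"
    proof (rule integral_mono)
      show "integrable M1 (\<lambda>x. g x y * H x powr (r - 1))"
        using y gH_bd by (intro A.integrable_const_bound[of _ "B * B powr (r - 1)"]) auto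
      show "integrable M1 (\<lambda>x. c powr (1 - r) * g x y powr r / r + (1 - 1 / r) * c * H x powr r)"
        using grI HrI by auto
      show "g x y * H x powr (r - 1) \<le> c powr (1 - r) * g x y powr r / r + (1 - 1 / r) * c * H x powr r"
        if "x \<in> space M1" for x
        using g_bd[OF that y] H_bd[OF that] c r by (intro young_scaled) auto
    qed
    also have "\<dots> = c powr (1 - r) * (LINT x|M1. g x y powr r) / r + (1 - 1 / r) * c * J"
      unfolding J_def using grI HrI by (subst Bochner_Integration.integral_add) auto
    also have "\<dots> \<le> c powr (1 - r) * n y powr r / r + (1 - 1 / r) * c * J"
      using le[OF y] r by (intro add_right_mono divide_right_mono mult_left_mono) auto
    also have "c powr (1 - r) * n y powr r = c * N powr r"
    proof -
      have "n y = c * N" using N by (simp add: c_def)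
      then have "c powr (1 - r) * n y powr r = c powr (1 - r) * c powr r * N powr r"
        using c N by (simp add: powr_mult)
      also have "c powr (1 - r) * c powr r = c" using c by (simp flip: powr_add)
      finally show ?thesis .
    qed
    finally show "(LINT x|M1. g x y * H x powr (r - 1)) \<le> n y / N * (N powr r / r + (1 - 1 / r) * J)"
      by (simp add: c_def algebra_simps)
  qed
  also have "\<dots> = N powr r / r + (1 - 1 / r) * J"
    using N by (simp add: N_def[symmetric])
  \<comment> \<open>The real number \<open>J\<close> occurs on both sides; absorbing it leaves
    \<open>J / r\<close> on the left.\<close>
  finally have "J \<le> N powr r"
    using r by (simp add: field_simps)
  then show ?thesis by (simp add: J_def H_def N_def)
qed

text \<open>Minkowski's integral inequality, with \<open>n\<close> dominating the inner \<open>L\<^sup>r\<close> norms, so that their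
  measurability in \<open>y\<close> is not an issue.\<close>

lemma minkowski_integral:
  fixes g :: "'a \<Rightarrow> 'b \<Rightarrow> real" and n :: "'b \<Rightarrow> real"
  assumes M1: "prob_space M1" and M2: "prob_space M2" and r: "1 \<le> r"
    and g: "case_prod g \<in> borel_measurable (M1 \<Otimes>\<^sub>M M2)"
    and g_bd: "\<And>x y. x \<in> space M1 \<Longrightarrow> y \<in> space M2 \<Longrightarrow> 0 \<le> g x y \<and> g x y \<le> B"
    and n: "integrable M2 n" and n_nonneg: "\<And>y. y \<in> space M2 \<Longrightarrow> 0 \<le> n y"
    and le: "\<And>y. y \<in> space M2 \<Longrightarrow> (LINT x|M1. g x y powr r) \<le> n y powr r"
  shows "(LINT x|M1. (LINT y|M2. g x y) powr r) \<le> (LINT y|M2. n y) powr r"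
proof -
  interpret B: prob_space M2 by (rule M2)
  let ?J = "LINT x|M1. (LINT y|M2. g x y) powr r"
  have N: "0 \<le> (LINT y|M2. n y)" using n_nonneg by (intro Bochner_Integration.integral_nonneg) auto
  have J: "0 \<le> ?J" by simp
  have "?J powr (1 / r) \<le> (LINT y|M2. n y)"
  proof (rule field_le_epsilon)
    \<comment> \<open>Adding \<open>e\<close> makes the majorant strictly positive. After taking the
      root the resulting error is just \<open>e\<close>.\<close>
    fix e :: real assume e: "0 < e"
    have "?J \<le> (LINT y|M2. n y + e) powr r"
    proof (rule minkowski_integral_pos[OF M1 M2 r g g_bd])
      fix y assume y: "y \<in> space M2"
      show "0 < n y + e" using n_nonneg[OF y] e by simp
      have "n y powr r \<le> (n y + e) powr r" using n_nonneg[OF y] e r by (intro powr_mono2) auto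
      then show "(LINT x|M1. g x y powr r) \<le> (n y + e) powr r" using le[OF y] by simp
    qed (use n in auto)
    also have "(LINT y|M2. n y + e) = (LINT y|M2. n y) + e"
      using n by (simp add: B.prob_space)
    finally have "?J powr (1 / r) \<le> (((LINT y|M2. n y) + e) powr r) powr (1 / r)"
      using r J by (intro powr_mono2) auto
    then show "?J powr (1 / r) \<le> (LINT y|M2. n y) + e"
      using r N e by (simp add: powr_powr)
  qed
  then have "(?J powr (1 / r)) powr r \<le> (LINT y|M2. n y) powr r"
    using r by (intro powr_mono2) auto
  then show ?thesis using r J by (simp add: powr_powr)
qed

text \<open>Induction on the set of integrated coordinates, the others being frozen. For a new
  coordinate the slice inequality is applied inside. The remaining power \<open>p / s\<close>, at
  least 1, is moved inward by Minkowski, with the induction hypothesis bounding the inner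
  norms.\<close>

lemma product_Lp_le:
  fixes f :: "('i::finite \<Rightarrow> 'a) \<Rightarrow> real" and K p s B :: real
  assumes M: "prob_space M" and s: "0 < s" "s \<le> p"
    and f[measurable]: "f \<in> borel_measurable (Pi\<^sub>M UNIV (\<lambda>_. M))"
    and f_bd: "\<And>x. (\<And>i. x i \<in> space M) \<Longrightarrow> 0 \<le> f x \<and> f x \<le> B"
    and slice: "\<And>x i. (\<And>i. x i \<in> space M) \<Longrightarrow>
      (LINT t|M. f (x(i := t)) powr p) \<le> K powr p * (LINT t|M. f (x(i := t)) powr s) powr (p / s)"
  shows "(LINT x|Pi\<^sub>M UNIV (\<lambda>_. M). f x powr p)
    \<le> (K powr p) ^ CARD('i) * (LINT x|Pi\<^sub>M UNIV (\<lambda>_. M). f x powr s) powr (p / s)"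
proof -
  interpret M: prob_space M by (rule M)
  interpret PM: product_prob_space "\<lambda>_::'i. M" ..
  define ov where "ov I x z = (\<lambda>j. if j \<in> I then x j else z j)" for I and x z :: "'i \<Rightarrow> 'a"
  have "(LINT x|Pi\<^sub>M I (\<lambda>_. M). f (ov I x z) powr p)
    \<le> (K powr p) ^ card I * (LINT x|Pi\<^sub>M I (\<lambda>_. M). f (ov I x z) powr s) powr (p / s)"
    if "finite I" and "\<And>i. z i \<in> space M" for I z
    using that
  proof (induction I arbitrary: z rule: finite_induct)
    case empty
    interpret E: prob_space "Pi\<^sub>M {} (\<lambda>_::'i. M)" by (intro prob_space_PiM M)
    have "ov {} x z = z" for x by (simp add: ov_def)
    then show ?case using s f_bd[of z] empty by (simp add: E.prob_space powr_powr)
  next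
    case (insert i I)
    interpret PI: prob_space "Pi\<^sub>M I (\<lambda>_::'i. M)" by (intro prob_space_PiM M)
    interpret PiI: prob_space "Pi\<^sub>M (insert i I) (\<lambda>_::'i. M)" by (intro prob_space_PiM M)
    interpret P: pair_prob_space "Pi\<^sub>M I (\<lambda>_::'i. M)" M ..
    define r where "r = p / s"
    have r: "1 \<le> r" and sr: "s * r = p" using s by (auto simp: r_def)
    note z = insert.prems
    have zm [measurable]: "(\<lambda>_. z j) \<in> N \<rightarrow>\<^sub>M M" for j and N :: "'z measure"
      using z by simp
    define F where "F x = f (ov (insert i I) x z)" for x
    define g where "g x y = f (ov I x (z(i := y))) powr s" for x y
    have Fg: "F (x(i := y)) = f (ov I x (z(i := y)))" for x y
      unfolding F_def ov_def using insert.hyps by (intro arg_cong[of _ _ f] ext) auto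
    have Fg': "F (x(i := y)) = f ((ov I x z)(i := y))" for x y
      unfolding F_def ov_def using insert.hyps by (intro arg_cong[of _ _ f] ext) auto
    have ov_in: "ov I' x z' j \<in> space M" if "x \<in> space (Pi\<^sub>M I' (\<lambda>_. M))" "\<And>i. z' i \<in> space M" for I' x z' j
      using that by (auto simp: ov_def space_PiM PiE_def Pi_def)
    have B: "0 \<le> B" using f_bd[of z] z by force
    have [measurable]: "(\<lambda>x. ov (insert i I) x z) \<in> Pi\<^sub>M (insert i I) (\<lambda>_. M) \<rightarrow>\<^sub>M Pi\<^sub>M UNIV (\<lambda>_. M)"
    proof -
      have "(\<lambda>x. ov (insert i I) x z j) \<in> Pi\<^sub>M (insert i I) (\<lambda>_. M) \<rightarrow>\<^sub>M M" for j
        using z[of j] unfolding ov_def by (cases "j \<in> insert i I") auto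
      then show ?thesis
        by (intro measurable_PiM_single') (auto simp: ov_in z)
    qed
    have ovm [measurable]: "(\<lambda>(x, y). ov I x (z(i := y))) \<in> (Pi\<^sub>M I (\<lambda>_. M) \<Otimes>\<^sub>M M) \<rightarrow>\<^sub>M Pi\<^sub>M UNIV (\<lambda>_. M)"
    proof -
      have "(\<lambda>p. ov I (fst p) (z(i := snd p)) j) \<in> (Pi\<^sub>M I (\<lambda>_. M) \<Otimes>\<^sub>M M) \<rightarrow>\<^sub>M M" for j
        using z[of j] unfolding ov_def by (cases "j \<in> I"; cases "j = i") auto
      then have "(\<lambda>p. ov I (fst p) (z(i := snd p))) \<in> (Pi\<^sub>M I (\<lambda>_. M) \<Otimes>\<^sub>M M) \<rightarrow>\<^sub>M Pi\<^sub>M UNIV (\<lambda>_. M)"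
        by (intro measurable_PiM_single') (auto simp: ov_in z space_pair_measure)
      then show ?thesis by (simp add: case_prod_beta')
    qed
    have F_m [measurable]: "F \<in> borel_measurable (Pi\<^sub>M (insert i I) (\<lambda>_. M))"
      unfolding F_def by measurable
    have g_m [measurable]: "case_prod g \<in> borel_measurable (Pi\<^sub>M I (\<lambda>_. M) \<Otimes>\<^sub>M M)"
    proof -
      have "(\<lambda>p. f ((\<lambda>(x, y). ov I x (z(i := y))) p) powr s) \<in> borel_measurable (Pi\<^sub>M I (\<lambda>_. M) \<Otimes>\<^sub>M M)"
        by measurable
      then show ?thesis unfolding g_def by (simp add: case_prod_beta')
    qed
    have F_bd: "0 \<le> F x \<and> F x \<le> B" if "x \<in> space (Pi\<^sub>M (insert i I) (\<lambda>_. M))" for x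
      unfolding F_def using that z by (intro f_bd ov_in)
    have fg_bd: "0 \<le> f (ov I x (z(i := y))) \<and> f (ov I x (z(i := y))) \<le> B"
      if "x \<in> space (Pi\<^sub>M I (\<lambda>_. M))" "y \<in> space M" for x y
      using that z by (intro f_bd ov_in) auto
    have g_bd: "0 \<le> g x y \<and> g x y \<le> B powr s"
      if "x \<in> space (Pi\<^sub>M I (\<lambda>_. M))" "y \<in> space M" for x y
      unfolding g_def using fg_bd[OF that] s by (auto intro!: powr_mono2)
    have FI: "integrable (Pi\<^sub>M (insert i I) (\<lambda>_. M)) (\<lambda>x. F x powr q)" if "0 < q" for q
      using F_bd that by (intro PiI.integrable_const_bound[of _ "B powr q"]) (auto intro!: AE_I2 powr_mono2)
    have g_I: "integrable (Pi\<^sub>M I (\<lambda>_. M) \<Otimes>\<^sub>M M) (case_prod g)"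
      using g_bd by (intro P.P.integrable_const_bound[of _ "B powr s"]) (auto simp: space_pair_measure intro!: AE_I2)
    have Kpow: "((K powr s) ^ k) powr r = (K powr p) ^ k" for k
      by (induction k) (simp_all add: powr_mult powr_powr sr)
    have gr: "g x y powr r = F (x(i := y)) powr p" for x y
      unfolding g_def Fg powr_powr sr ..
    have gr_I: "integrable (Pi\<^sub>M I (\<lambda>_. M) \<Otimes>\<^sub>M M) (\<lambda>(x, y). g x y powr r)"
      using g_bd r by (intro P.P.integrable_const_bound[of _ "(B powr s) powr r"])
        (auto simp: space_pair_measure intro!: AE_I2 powr_mono2)
    have G_bd: "0 \<le> (LINT y|M. g x y) \<and> (LINT y|M. g x y) \<le> B powr s" if x: "x \<in> space (Pi\<^sub>M I (\<lambda>_. M))" for x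
    proof
      show "0 \<le> (LINT y|M. g x y)" using g_bd[OF x] by (intro Bochner_Integration.integral_nonneg) auto
      have "(LINT y|M. g x y) \<le> (LINT y|M. B powr s)"
        using g_bd[OF x] x by (intro integral_mono M.integrable_const_bound[of _ "B powr s"]) auto
      then show "(LINT y|M. g x y) \<le> B powr s" by (simp add: M.prob_space)
    qed
    have "(LINT x|Pi\<^sub>M (insert i I) (\<lambda>_. M). F x powr p)
        = (LINT x|Pi\<^sub>M I (\<lambda>_. M). (LINT y|M. g x y powr r))"
      unfolding gr using s insert.hyps FI[of p]
      by (intro PM.product_integral_insert) auto
    also have "\<dots> \<le> (LINT x|Pi\<^sub>M I (\<lambda>_. M). K powr p * (LINT y|M. g x y) powr r)"
    proof (rule integral_mono)
      show "integrable (Pi\<^sub>M I (\<lambda>_. M)) (\<lambda>x. LINT y|M. g x y powr r)"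
        using P.integrable_fst[OF gr_I] .
      have "integrable (Pi\<^sub>M I (\<lambda>_. M)) (\<lambda>x. (LINT y|M. g x y) powr r)"
        using G_bd r by (intro PI.integrable_const_bound[of _ "(B powr s) powr r"]) (auto intro!: AE_I2 powr_mono2)
      then show "integrable (Pi\<^sub>M I (\<lambda>_. M)) (\<lambda>x. K powr p * (LINT y|M. g x y) powr r)" by simp
      fix x assume x: "x \<in> space (Pi\<^sub>M I (\<lambda>_. M))"
      show "(LINT y|M. g x y powr r) \<le> K powr p * (LINT y|M. g x y) powr r"
        unfolding gr using slice[of "ov I x z" i, OF ov_in[OF x z]]
        unfolding g_def Fg[symmetric] unfolding Fg' r_def .
    qed
    also have "\<dots> = K powr p * (LINT x|Pi\<^sub>M I (\<lambda>_. M). (LINT y|M. g x y) powr r)"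
      by simp
    \<comment> \<open>The induction hypothesis at \<open>z(i := y)\<close> says that this integrand
      dominates the norm of \<open>g\<close> in \<open>x\<close> with exponent \<open>r\<close>. Its
      constant carries \<open>K powr s\<close>, since \<open>s * r = p\<close>.\<close>
    also have "\<dots> \<le> K powr p * (LINT y|M. (K powr s) ^ card I * (LINT x|Pi\<^sub>M I (\<lambda>_. M). g x y)) powr r"
    proof (intro mult_left_mono minkowski_integral[OF PI.prob_space_axioms M r g_m g_bd])
      show "integrable M (\<lambda>y. (K powr s) ^ card I * (LINT x|Pi\<^sub>M I (\<lambda>_. M). g x y))"
        using P.integrable_snd[OF g_I] by simp
      fix y assume y: "y \<in> space M"
      have g0: "0 \<le> (LINT x|Pi\<^sub>M I (\<lambda>_. M). g x y)"
        using g_bd[OF _ y] by (intro Bochner_Integration.integral_nonneg) auto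
      then show "0 \<le> (K powr s) ^ card I * (LINT x|Pi\<^sub>M I (\<lambda>_. M). g x y)" by simp
      have zy: "(z(i := y)) j \<in> space M" for j using y z by simp
      have "(LINT x|Pi\<^sub>M I (\<lambda>_. M). g x y powr r) \<le> (K powr p) ^ card I * (LINT x|Pi\<^sub>M I (\<lambda>_. M). g x y) powr r"
        using insert.IH[of "z(i := y)", OF zy] unfolding gr Fg unfolding g_def r_def .
      also have "\<dots> = ((K powr s) ^ card I * (LINT x|Pi\<^sub>M I (\<lambda>_. M). g x y)) powr r"
        using g0 by (simp add: powr_mult Kpow)
      finally show "(LINT x|Pi\<^sub>M I (\<lambda>_. M). g x y powr r)
        \<le> ((K powr s) ^ card I * (LINT x|Pi\<^sub>M I (\<lambda>_. M). g x y)) powr r" .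
    qed auto
    also have "(LINT y|M. (K powr s) ^ card I * (LINT x|Pi\<^sub>M I (\<lambda>_. M). g x y))
      = (K powr s) ^ card I * (LINT x|Pi\<^sub>M (insert i I) (\<lambda>_. M). F x powr s)"
      using s insert.hyps FI[of s] P.Fubini_integral[OF g_I]
      by (subst PM.product_integral_insert) (auto simp: g_def Fg)
    also have "K powr p * (\<dots>) powr r = (K powr p) ^ card (insert i I) * (LINT x|Pi\<^sub>M (insert i I) (\<lambda>_. M). F x powr s) powr r"
      using insert.hyps by (simp add: powr_mult Kpow mult.assoc)
    finally show ?case unfolding F_def r_def .
  qed
  note main = this
  obtain z0 where "z0 \<in> space M" using M.not_empty by blast
  then have "(LINT x|Pi\<^sub>M UNIV (\<lambda>_. M). f (ov UNIV x (\<lambda>_. z0)) powr p)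
    \<le> (K powr p) ^ CARD('i) * (LINT x|Pi\<^sub>M UNIV (\<lambda>_. M). f (ov UNIV x (\<lambda>_. z0)) powr s) powr (p / s)"
    by (intro main) auto
  then show ?thesis by (simp add: ov_def)
qed

section \<open>The torus\<close>

lemma measurable_vec_lambda [measurable]:
  "vec_lambda \<in> Pi\<^sub>M (UNIV :: 'n::finite set) (\<lambda>_. circle_measure) \<rightarrow>\<^sub>M borel"
proof -
  have "(\<lambda>x. vec_lambda x \<bullet> b) \<in> borel_measurable (Pi\<^sub>M UNIV (\<lambda>_. circle_measure))"
    if b_in: "b \<in> Basis" for b :: "complex ^ 'n"
  proof -
    obtain i c where b: "b = axis i c" using b_in by (auto simp: Basis_vec_def)
    have [measurable]: "(\<lambda>x. x i) \<in> borel_measurable (Pi\<^sub>M UNIV (\<lambda>_. circle_measure))"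
      by (rule measurable_compose[where g = "\<lambda>z. z" and L = borel and N = circle_measure]) auto
    show ?thesis unfolding b inner_axis by simp
  qed
  then show ?thesis by (subst borel_measurable_euclidean_space) auto
qed

lemma measurable_vec_lambda_torus [measurable]:
  "vec_lambda \<in> Pi\<^sub>M (UNIV :: 'n::finite set) (\<lambda>_. circle_measure) \<rightarrow>\<^sub>M restrict_space borel torus"
  by (intro measurable_restrict_space2) (auto simp: space_PiM torus_def)

lemma prob_space_torus: "prob_space torus_measure"
proof -
  interpret prob_space "Pi\<^sub>M (UNIV :: 'n::finite set) (\<lambda>_. circle_measure)"
    by (intro prob_space_PiM prob_space_circle)
  show ?thesis
    unfolding torus_measure_def
    by (intro prob_space.prob_space_completion prob_space_distr measurable_vec_lambda_torus)
qed

lemma space_torus [simp]: "space torus_measure = torus"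
  by (simp add: torus_measure_def space_restrict_space)

lemma torus_measurable:
  assumes "f \<in> borel_measurable borel"
  shows "f \<in> borel_measurable torus_measure"
  unfolding torus_measure_def
  by (intro measurable_completion) (use assms in \<open>simp add: measurable_restrict_space1\<close>)

lemma torus_integral:
  fixes f :: "complex ^ 'n::finite \<Rightarrow> real"
  assumes "f \<in> borel_measurable borel"
  shows "(LINT z|torus_measure. f z) = (LINT x|Pi\<^sub>M UNIV (\<lambda>_. circle_measure). f (vec_lambda x))"
  unfolding torus_measure_def using assms
  by (simp add: integral_completion integral_distr measurable_restrict_space1)

section \<open>Evaluation and slices of polynomials on the torus\<close>

lemma continuous_cpoly_eval: "continuous_on S (cpoly_eval P)"
  unfolding cpoly_eval_def[abs_def] by (intro continuous_intros)

lemma cpoly_eval_measurable [measurable]: "cpoly_eval P \<in> borel_measurable borel"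
  by (intro borel_measurable_continuous_onI continuous_cpoly_eval)

lemma norm_cpoly_eval_le:
  assumes "z \<in> torus"
  shows "norm (cpoly_eval P z) \<le> (\<Sum>\<alpha>\<in>Poly_Mapping.keys P. norm (Poly_Mapping.lookup P \<alpha>))"
  unfolding cpoly_eval_def
proof (intro order_trans[OF norm_sum] sum_mono)
  fix \<alpha>
  have "norm (\<Prod>j\<in>UNIV. (z $ j) ^ (\<alpha> $ j)) = 1"
    using assms by (simp add: prod_norm[symmetric] norm_power torus_def)
  then show "norm (Poly_Mapping.lookup P \<alpha> * (\<Prod>j\<in>UNIV. (z $ j) ^ (\<alpha> $ j)))
      \<le> norm (Poly_Mapping.lookup P \<alpha>)"
    by (simp add: norm_mult)
qed

lemma le_deg_infty:
  assumes "\<alpha> \<in> Poly_Mapping.keys P"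
  shows "\<alpha> $ j \<le> deg_infty P"
proof -
  have S: "{\<alpha> $ j |\<alpha>. Poly_Mapping.lookup P \<alpha> \<noteq> 0} = (\<lambda>\<alpha>. \<alpha> $ j) ` Poly_Mapping.keys P" for j
    by (auto simp: in_keys_iff)
  have "P \<noteq> 0" using assms by auto
  then have d: "deg_infty P = (MAX j\<in>UNIV. Max ((\<lambda>\<alpha>. \<alpha> $ j) ` Poly_Mapping.keys P))"
    unfolding deg_infty_def S by simp
  have "\<alpha> $ j \<le> Max ((\<lambda>\<alpha>. \<alpha> $ j) ` Poly_Mapping.keys P)"
    using assms by (intro Max_ge) auto
  also have "\<dots> \<le> deg_infty P"
    unfolding d by (intro Max_ge) auto
  finally show ?thesis .
qed

lemma cpoly_slice:
  fixes P :: "'n::finite cpoly"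
  obtains Q where "degree Q \<le> deg_infty P" "\<And>t. cpoly_eval P (vec_lambda (x(i := t))) = poly Q t"
proof
  let ?Q = "\<Sum>\<alpha>\<in>Poly_Mapping.keys P.
    monom (Poly_Mapping.lookup P \<alpha> * (\<Prod>j\<in>UNIV - {i}. x j ^ (\<alpha> $ j))) (\<alpha> $ i)"
  show "degree ?Q \<le> deg_infty P"
    by (intro degree_sum_le) (auto intro: order_trans[OF degree_monom_le le_deg_infty])
  show "cpoly_eval P (vec_lambda (x(i := t))) = poly ?Q t" for t
    unfolding cpoly_eval_def poly_sum poly_monom
  proof (intro sum.cong refl)
    fix \<alpha>
    have "(\<Prod>j\<in>UNIV. (vec_lambda (x(i := t)) $ j) ^ (\<alpha> $ j))
        = t ^ (\<alpha> $ i) * (\<Prod>j\<in>UNIV - {i}. x j ^ (\<alpha> $ j))"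
      by (subst prod.remove[of _ i]) (auto intro!: prod.cong)
    then show "Poly_Mapping.lookup P \<alpha> * (\<Prod>j\<in>UNIV. (vec_lambda (x(i := t)) $ j) ^ (\<alpha> $ j))
        = Poly_Mapping.lookup P \<alpha> * (\<Prod>j\<in>UNIV - {i}. x j ^ (\<alpha> $ j)) * t ^ (\<alpha> $ i)"
      by simp
  qed
qed

lemma Lam_nonneg: "0 \<le> Lam p m"
  by (simp add: Lam_def)

text \<open>The one-variable comparison serves as slice inequality. Its constant depends on neither
  the slice nor \<open>s\<close>, so \<open>s\<close> can later tend to 0.\<close>

lemma torus_Lp_le:
  fixes P :: "'n::finite cpoly"
  assumes s: "0 < s" "s \<le> p"
  shows "(LINT z|torus_measure. norm (cpoly_eval P z) powr p) powr (1 / p)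
    \<le> Lam p (deg_infty P) ^ CARD('n) * (LINT z|torus_measure. norm (cpoly_eval P z) powr s) powr (1 / s)"
proof -
  let ?L = "Lam p (deg_infty P)"
  define f where "f x = norm (cpoly_eval P (vec_lambda x))" for x :: "'n \<Rightarrow> complex"
  have p: "0 < p" using s by simp
  have "(LINT x|Pi\<^sub>M UNIV (\<lambda>_. circle_measure). f x powr p)
    \<le> (?L powr p) ^ CARD('n) * (LINT x|Pi\<^sub>M UNIV (\<lambda>_. circle_measure). f x powr s) powr (p / s)"
  proof (rule product_Lp_le[OF prob_space_circle s])
    show "f \<in> borel_measurable (Pi\<^sub>M UNIV (\<lambda>_. circle_measure))"
      unfolding f_def by measurable
    fix x :: "'n \<Rightarrow> complex" assume x: "\<And>i. x i \<in> space circle_measure"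
    then show "0 \<le> f x \<and> f x \<le> (\<Sum>\<alpha>\<in>Poly_Mapping.keys P. norm (Poly_Mapping.lookup P \<alpha>))"
      unfolding f_def by (auto intro!: norm_cpoly_eval_le simp: torus_def)
    fix i
    obtain Q where Q: "degree Q \<le> deg_infty P"
      "\<And>t. cpoly_eval P (vec_lambda (x(i := t))) = poly Q t"
      using cpoly_slice[of P x i] by blast
    let ?I = "\<lambda>q. LINT t|circle_measure. norm (poly Q t) powr q"
    have "(?I p powr (1 / p)) powr p \<le> (?L * ?I s powr (1 / s)) powr p"
      using p by (intro powr_mono2 poly_circle_Lp_le Q s) auto
    then show "(LINT t|circle_measure. f (x(i := t)) powr p)
      \<le> ?L powr p * (LINT t|circle_measure. f (x(i := t)) powr s) powr (p / s)"
      unfolding f_def Q(2) using p by (simp add: powr_mult powr_powr)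
  qed
  then have "((LINT z|torus_measure. norm (cpoly_eval P z) powr p)) powr (1 / p)
    \<le> ((?L powr p) ^ CARD('n) * (LINT z|torus_measure. norm (cpoly_eval P z) powr s) powr (p / s)) powr (1 / p)"
    using p by (intro powr_mono2) (auto simp: f_def torus_integral)
  also have "\<dots> = ((?L powr p) ^ CARD('n)) powr (1 / p) * (LINT z|torus_measure. norm (cpoly_eval P z) powr s) powr (1 / s)"
    using p by (simp add: powr_mult powr_powr)
  also have "((?L powr p) ^ k) powr (1 / p) = ?L ^ k" for k
    using p by (induction k) (simp_all add: powr_mult powr_powr Lam_nonneg)
  finally show ?thesis .
qed

section \<open>Means of small powers and their limit\<close>

lemma powr_le_tangent:
  fixes x t s :: real
  assumes "0 \<le> x" "0 < t" "0 < s" "s < 1"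
  shows "x powr s \<le> s * t powr (s - 1) * x + (1 - s) * t powr s"
proof (cases "x = 0")
  case False
  then have "x powr s * t powr (1 - s) \<le> s * x + (1 - s) * t"
    using assms by (intro Youngs_inequality_0) auto
  then have "x powr s * t powr (1 - s) * t powr (s - 1) \<le> (s * x + (1 - s) * t) * t powr (s - 1)"
    by (intro mult_right_mono) auto
  moreover have "t powr (1 - s) * t powr (s - 1) = 1" "t * t powr (s - 1) = t powr s"
    using assms by (simp_all add: powr_mult_base flip: powr_add)
  ultimately show ?thesis by (simp add: algebra_simps)
qed (use assms in auto)

text \<open>The tangent at \<open>t\<close> is used on \<open>E\<close> and the one at
  \<open>u\<close> off \<open>E\<close>. Both are affine in \<open>f\<close>, so only integrals of
  \<open>f\<close> and the probability of \<open>E\<close> survive.\<close>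

lemma (in prob_space) integral_powr_le:
  fixes f :: "'a \<Rightarrow> real"
  assumes f: "integrable M f" "\<And>x. x \<in> space M \<Longrightarrow> 0 \<le> f x"
    and E: "E \<in> sets M" and tu: "0 < t" "0 < u" and s: "0 < s" "s < 1"
  shows "(LINT x|M. f x powr s) \<le>
      s * t powr (s - 1) * (LINT x:E|M. f x) + (1 - s) * t powr s * prob E
    + (s * u powr (s - 1) * ((LINT x|M. f x) - (LINT x:E|M. f x)) + (1 - s) * u powr s * (1 - prob E))"
proof -
  have fE: "integrable M (\<lambda>x. indicator E x * f x)"
    using f(1) E by (simp add: integrable_real_mult_indicator mult.commute)
  have pt: "f x powr s \<le> s * t powr (s - 1) * (indicator E x * f x) + (1 - s) * t powr s * indicator E x
      + (s * u powr (s - 1) * (f x - indicator E x * f x) + (1 - s) * u powr s * (1 - indicator E x))"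
    if "x \<in> space M" for x
    using powr_le_tangent[of "f x" t s] powr_le_tangent[of "f x" u s] f(2)[OF that] tu s
    by (cases "x \<in> E") auto
  have "(LINT x|M. f x powr s) \<le> (LINT x|M. s * t powr (s - 1) * (indicator E x * f x) + (1 - s) * t powr s * indicator E x
    + (s * u powr (s - 1) * (f x - indicator E x * f x) + (1 - s) * u powr s * (1 - indicator E x)))"
  proof (rule integral_mono')
    show "integrable M (\<lambda>x. s * t powr (s - 1) * (indicator E x * f x) + (1 - s) * t powr s * indicator E x
      + (s * u powr (s - 1) * (f x - indicator E x * f x) + (1 - s) * u powr s * (1 - indicator E x)))"
      using f(1) fE E by (intro Bochner_Integration.integrable_add Bochner_Integration.integrable_diff integrable_mult_right)
        (auto simp: less_top[symmetric])
  qed (use pt order_trans[OF powr_ge_zero pt] in auto)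
  also have "\<dots> = s * t powr (s - 1) * (LINT x|M. indicator E x * f x) + (1 - s) * t powr s * prob E
    + (s * u powr (s - 1) * ((LINT x|M. f x) - (LINT x|M. indicator E x * f x)) + (1 - s) * u powr s * (1 - prob E))"
    using f(1) fE E
    by (simp add: prob_space less_top[symmetric])
  finally show ?thesis by (simp add: set_lebesgue_integral_def)
qed

text \<open>Letting \<open>s \<longrightarrow> 0\<close> replaces Jensen's inequality for the Mahler measure \<open>exp (\<integral> log |f|)\<close>, and thereby
  any question about the integrability of \<open>log |f|\<close>.\<close>

lemma (in prob_space) le_of_le_small_Lp:
  fixes f :: "'a \<Rightarrow> real"
  assumes f: "integrable M f" "\<And>x. x \<in> space M \<Longrightarrow> 0 \<le> f x"
    and E: "E \<in> sets M" and tu: "0 < t" "0 < u" and p: "0 < p" and L: "0 \<le> L"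
    and le: "\<And>s. 0 < s \<Longrightarrow> s \<le> p \<Longrightarrow> X \<le> L * (LINT x|M. f x powr s) powr (1 / s)"
  shows "X \<le> L * (exp ((LINT x:E|M. f x) / t + ((LINT x|M. f x) - (LINT x:E|M. f x)) / u - 1)
    * (t powr prob E * u powr (1 - prob E)))"
proof -
  define A where "A = (LINT x:E|M. f x)"
  define D where "D = (LINT x|M. f x) - A"
  define l where "l = prob E"
  \<comment> \<open>\<open>G\<close> is the tangent bound as a function of \<open>s\<close>. The
    weights \<open>l\<close> and \<open>1 - l\<close> give \<open>G 0 = 1\<close>, so
    \<open>(G s - 1) / s\<close> tends to the derivative at 0.\<close>
  define G where "G s = s * t powr (s - 1) * A + (1 - s) * t powr s * l
    + (s * u powr (s - 1) * D + (1 - s) * u powr s * (1 - l))" for s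
  have G0: "G 0 = 1" using tu by (simp add: G_def)
  have "(G has_real_derivative (A / t + D / u - 1 + (l * ln t + (1 - l) * ln u))) (at 0)"
    unfolding G_def[abs_def]
    by (rule derivative_eq_intros refl | use tu in \<open>simp add: powr_minus field_simps\<close>)+
  then have "((\<lambda>s. (G s - 1) / s) \<longlongrightarrow> A / t + D / u - 1 + (l * ln t + (1 - l) * ln u)) (at_right 0)"
    unfolding has_field_derivative_iff G0 by (auto intro: tendsto_mono[OF at_le])
  then have lim: "((\<lambda>s. L * exp ((G s - 1) / s)) \<longlongrightarrow> L * exp (A / t + D / u - 1 + (l * ln t + (1 - l) * ln u))) (at_right 0)"
    by (intro tendsto_intros)
  have "X \<le> L * exp (A / t + D / u - 1 + (l * ln t + (1 - l) * ln u))"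
  proof (rule tendsto_lowerbound[OF lim])
    have "\<forall>\<^sub>F s in at_right 0. 0 < s \<and> s < min p 1"
      using p by (intro eventually_at_rightI[of 0 "min p 1"]) auto
    then show "\<forall>\<^sub>F s in at_right 0. X \<le> L * exp ((G s - 1) / s)"
    proof eventually_elim
      case (elim s)
      have "(LINT x|M. f x powr s) \<le> G s"
        using integral_powr_le[OF f E tu, of s] elim unfolding G_def A_def D_def l_def by simp
      \<comment> \<open>This replaces the power \<open>1 / s\<close> of \<open>G s\<close> by an
        exponential of a difference quotient.\<close>
      also have "\<dots> \<le> exp (G s - 1)" using exp_ge_add_one_self[of "G s - 1"] by simp
      finally have "(LINT x|M. f x powr s) powr (1 / s) \<le> exp (G s - 1) powr (1 / s)"
        using elim by (intro powr_mono2) auto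
      also have "\<dots> = exp ((G s - 1) / s)" by (simp add: exp_powr_real)
      finally show ?case using le[of s] elim L by (meson less_imp_le min.strict_boundedE mult_left_mono order_trans)
    qed
  qed simp
  also have "exp (A / t + D / u - 1 + (l * ln t + (1 - l) * ln u)) = exp (A / t + D / u - 1) * (t powr l * u powr (1 - l))"
    using tu by (simp add: powr_def exp_add)
  finally show ?thesis by (simp add: A_def D_def l_def)
qed

section \<open>The constant and the choice of the tangency points\<close>

lemma C_const_le_2:
  assumes "0 < t" "t < 1"
  shows "C_const t \<le> 2"
proof -
  \<comment> \<open>Weighted AM-GM for \<open>1 / t\<close> and \<open>1 / (1 - t)\<close> with
    weights \<open>t\<close> and \<open>1 - t\<close>; each term of the arithmetic mean is
    1.\<close>
  have "(1 / t) powr t * (1 / (1 - t)) powr (1 - t) \<le> t * (1 / t) + (1 - t) * (1 / (1 - t))"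
    using assms by (intro Youngs_inequality_0) auto
  then show ?thesis
    using assms by (simp add: C_const_def rpow_def powr_divide)
qed

lemma C_const_1: "C_const 1 = 1"
  by (simp add: C_const_def rpow_def)

text \<open>The points \<open>t = A / \<theta>\<close> and \<open>u = B / (1 - \<theta>)\<close>
  make the exponential at most 1 and produce \<open>C_const \<theta>\<close>. If
  \<open>t \<le> u\<close>, lowering the weight \<open>l\<close> to \<open>\<theta>\<close> only
  enlarges the weighted geometric mean. If \<open>t > u\<close>, taking both points equal to
  \<open>B\<close> suffices, because \<open>A\<close> is then comparable to
  \<open>B\<close>.\<close>

lemma optimize_weights:
  fixes A B X L l \<theta> :: real
  assumes \<theta>: "0 < \<theta>" "\<theta> < 1" and l: "\<theta> \<le> l" and AB: "0 \<le> A" "A \<le> B" and L: "0 \<le> L"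
    and X: "\<And>t u. 0 < t \<Longrightarrow> 0 < u \<Longrightarrow> X \<le> L * (exp (A / t + (B - A) / u - 1) * (t powr l * u powr (1 - l)))"
  shows "X \<le> C_const \<theta> * L * B powr (1 - \<theta>) * A powr \<theta>"
proof -
  \<comment> \<open>\<open>A\<close> and \<open>B\<close> may vanish, so they are first enlarged to
    become admissible in denominators; the enlargement tends to 0 at the end.\<close>
  have le: "X \<le> C_const \<theta> * L * B' powr (1 - \<theta>) * A' powr \<theta>"
    if A': "A < A'" and B': "B < B'" for A' B'
  proof -
    have pos: "0 < A'" "0 < B'" using A' B' AB by auto
    have C: "C_const \<theta> = 1 / (\<theta> powr \<theta> * (1 - \<theta>) powr (1 - \<theta>))"
      using \<theta> by (simp add: C_const_def rpow_def)
    show ?thesis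
    proof (cases "A' / \<theta> \<le> B' / (1 - \<theta>)")
      case True
      define t u where "t = A' / \<theta>" and "u = B' / (1 - \<theta>)"
      have tu: "0 < t" "0 < u" "t \<le> u" using pos \<theta> True by (auto simp: t_def u_def)
      have "A / t \<le> \<theta>" using A' pos \<theta> by (simp add: t_def field_simps)
      moreover have "(B - A) / u \<le> 1 - \<theta>"
      proof -
        have "(B - A) * (1 - \<theta>) \<le> B' * (1 - \<theta>)" using B' AB \<theta> by (intro mult_right_mono) auto
        then show ?thesis using pos \<theta> by (simp add: u_def field_simps)
      qed
      ultimately have "exp (A / t + (B - A) / u - 1) \<le> 1" by simp
      moreover have "t powr l * u powr (1 - l) \<le> t powr \<theta> * u powr (1 - \<theta>)"
      proof -
        have "t powr (l - \<theta>) \<le> u powr (l - \<theta>)" using tu l by (intro powr_mono2) auto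
        then have "t powr \<theta> * t powr (l - \<theta>) * u powr (1 - l) \<le> t powr \<theta> * u powr (l - \<theta>) * u powr (1 - l)"
          by (intro mult_left_mono mult_right_mono) auto
        then show ?thesis using tu by (simp add: mult.assoc flip: powr_add)
      qed
      ultimately have "exp (A / t + (B - A) / u - 1) * (t powr l * u powr (1 - l)) \<le> 1 * (t powr \<theta> * u powr (1 - \<theta>))"
        by (rule mult_mono) auto
      then have "X \<le> L * (t powr \<theta> * u powr (1 - \<theta>))"
        using X[OF tu(1,2)] L by (simp add: mult_left_mono order_trans)
      also have "\<dots> = C_const \<theta> * L * B' powr (1 - \<theta>) * A' powr \<theta>"
        unfolding C t_def u_def using pos \<theta> by (simp add: powr_divide)
      finally show ?thesis .
    next
      case False
      have "exp (A / B' + (B - A) / B' - 1) \<le> 1"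
        using B' pos by (simp flip: add_divide_distrib)
      moreover have "B' powr l * B' powr (1 - l) = B'" using pos by (simp flip: powr_add)
      ultimately have "exp (A / B' + (B - A) / B' - 1) * (B' powr l * B' powr (1 - l)) \<le> B'"
        using pos by simp
      then have "X \<le> L * B'"
        using X[OF pos(2,2)] L by (meson mult_left_mono order_trans)
      moreover have "B' \<le> C_const \<theta> * (B' powr (1 - \<theta>) * A' powr \<theta>)"
      proof -
        \<comment> \<open>The failed comparison of the points yields
          \<open>\<theta> * B' \<le> A'\<close>, a lower bound for the factor
          \<open>A' powr \<theta>\<close>.\<close>
        have "\<theta> * B' * (1 - \<theta>) \<le> \<theta> * B'" using pos \<theta> by simp
        also have "\<dots> \<le> A' * (1 - \<theta>)" using False pos \<theta> by (simp add: field_simps)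
        finally have "\<theta> * B' \<le> A'" using \<theta> by simp
        then have "(\<theta> * B') powr \<theta> \<le> A' powr \<theta>" using pos \<theta> by (intro powr_mono2) auto
        then have "B' powr (1 - \<theta>) * (\<theta> * B') powr \<theta> \<le> B' powr (1 - \<theta>) * A' powr \<theta>"
          by (intro mult_left_mono) auto
        moreover have "B' powr (1 - \<theta>) * (\<theta> * B') powr \<theta> = \<theta> powr \<theta> * B'"
          using pos \<theta> by (simp add: powr_mult mult.left_commute flip: powr_add)
        moreover have "\<theta> powr \<theta> * (1 - \<theta>) powr (1 - \<theta>) * B' \<le> \<theta> powr \<theta> * B'"
          using pos \<theta> by (auto intro!: mult_left_le powr_le1)
        ultimately have "\<theta> powr \<theta> * (1 - \<theta>) powr (1 - \<theta>) * B' \<le> B' powr (1 - \<theta>) * A' powr \<theta>"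
          by simp
        then show ?thesis unfolding C using \<theta> by (simp add: field_simps)
      qed
      ultimately have "X \<le> L * (C_const \<theta> * (B' powr (1 - \<theta>) * A' powr \<theta>))"
        using L by (meson mult_left_mono order_trans)
      then show ?thesis by (simp add: mult_ac)
    qed
  qed
  have "((\<lambda>e. C_const \<theta> * L * (B + e) powr (1 - \<theta>) * (A + e) powr \<theta>) \<longlongrightarrow>
      C_const \<theta> * L * (B + 0) powr (1 - \<theta>) * (A + 0) powr \<theta>) (at_right 0)"
    using \<theta> AB by (intro tendsto_intros tendsto_powr') (auto simp: eventually_at_right_less intro!: eventually_at_rightI[of 0 1])
  then have "X \<le> C_const \<theta> * L * (B + 0) powr (1 - \<theta>) * (A + 0) powr \<theta>"
    by (rule tendsto_lowerbound) (auto intro!: eventually_at_rightI[of 0 1] le)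
  then show ?thesis by simp
qed

theorem theorem4p2:
  fixes \<theta> p :: real and E :: "(complex ^ 'n::finite) set" and P :: "'n cpoly" and m :: nat
  assumes "0 < \<theta>" and "\<theta> \<le> 1"
    and "E \<in> sets torus_measure" and "measure torus_measure E \<ge> \<theta>"
    and "deg_infty P = m" and "0 < p"
  shows "(Lp_norm p torus (cpoly_eval P)
           \<le> C_const \<theta> * Lam p m ^ CARD('n)
              * rpow (Lp_norm 1 torus (cpoly_eval P)) (1 - \<theta>)
              * rpow (Lp_norm 1 E (cpoly_eval P)) \<theta>)
         \<and> (\<forall>t. 0 < t \<and> t < 1 \<longrightarrow> C_const t \<le> 2)
         \<and> C_const 1 = 1"
proof (intro conjI allI impI)
  interpret prob_space "torus_measure :: (complex ^ 'n) measure" by (rule prob_space_torus)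
  define f where "f z = norm (cpoly_eval P z)" for z
  define A where "A = (LINT z:E|torus_measure. f z)"
  define B where "B = (LINT z|torus_measure. f z)"
  have f_int: "integrable torus_measure f"
    unfolding f_def using norm_cpoly_eval_le[of _ P]
    by (intro integrable_const_bound[where B = "\<Sum>\<alpha>\<in>Poly_Mapping.keys P. norm (Poly_Mapping.lookup P \<alpha>)"]
        torus_measurable AE_I2) auto
  have f0: "0 \<le> f z" for z by (simp add: f_def)
  have fE_int: "integrable torus_measure (\<lambda>z. indicator E z * f z)"
    using f_int assms(3) by (simp add: integrable_real_mult_indicator mult.commute)
  have A0: "0 \<le> A"
    unfolding A_def set_lebesgue_integral_def using f0 by (intro Bochner_Integration.integral_nonneg) auto
  have AB: "A \<le> B"
    unfolding A_def B_def set_lebesgue_integral_def using f_int fE_int f0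
    by (intro integral_mono) (auto simp: indicator_def)
  have N_E: "Lp_norm 1 E (cpoly_eval P) = A"
    using A0 unfolding Lp_norm_def A_def f_def by simp
  have torus: "(LINT z:torus|torus_measure. g z) = (LINT z|torus_measure. g z)" for g :: "complex ^ 'n \<Rightarrow> real"
    unfolding set_lebesgue_integral_def by (intro Bochner_Integration.integral_cong) auto
  have N_T: "Lp_norm 1 torus (cpoly_eval P) = B"
    using A0 AB unfolding Lp_norm_def torus B_def f_def by simp
  have N_p: "Lp_norm p torus (cpoly_eval P) = (LINT z|torus_measure. f z powr p) powr (1 / p)"
    unfolding Lp_norm_def torus f_def ..
  have L: "0 \<le> Lam p m ^ CARD('n)" by (simp add: Lam_nonneg)
  have X: "Lp_norm p torus (cpoly_eval P) \<le> Lam p m ^ CARD('n) *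
      (exp (A / t + (B - A) / u - 1) * (t powr prob E * u powr (1 - prob E)))" if "0 < t" "0 < u" for t u
    unfolding A_def B_def
  proof (rule le_of_le_small_Lp[OF f_int f0 assms(3) that assms(6) L])
    fix s assume "0 < s" "s \<le> p"
    then show "Lp_norm p torus (cpoly_eval P) \<le> Lam p m ^ CARD('n) * (LINT z|torus_measure. f z powr s) powr (1 / s)"
      unfolding N_p f_def assms(5)[symmetric] by (rule torus_Lp_le)
  qed
  show "Lp_norm p torus (cpoly_eval P)
           \<le> C_const \<theta> * Lam p m ^ CARD('n)
              * rpow (Lp_norm 1 torus (cpoly_eval P)) (1 - \<theta>)
              * rpow (Lp_norm 1 E (cpoly_eval P)) \<theta>"
  proof (cases "\<theta> = 1")
    case False
    then have "\<theta> < 1" using assms(2) by simp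
    from optimize_weights[OF assms(1) this assms(4) A0 AB L X] show ?thesis
      using False assms(1) unfolding N_E N_T by (simp add: rpow_def)
  next
    case True
    then have E1: "prob E = 1" using assms(4) prob_le_1[of E] by simp
    then have "AE z in torus_measure. z \<in> E" using assms(3) by (simp add: AE_in_set_eq_1)
    then have "A = B"
      unfolding A_def B_def set_lebesgue_integral_def using f_int fE_int
      by (intro integral_cong_AE) auto
    have "Lp_norm p torus (cpoly_eval P) \<le> Lam p m ^ CARD('n) * t" if "A < t" for t
    proof -
      have t: "0 < t" using A0 that by simp
      have "exp (A / t - 1) * t \<le> 1 * t"
        using that t by (intro mult_right_mono) auto
      then have "Lam p m ^ CARD('n) * (exp (A / t - 1) * t) \<le> Lam p m ^ CARD('n) * t"
        using L by (intro mult_left_mono) auto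
      then show ?thesis
        using X[OF t t] t by (simp add: E1 \<open>A = B\<close>)
    qed
    then have "Lp_norm p torus (cpoly_eval P) \<le> Lam p m ^ CARD('n) * (A + e)" if "0 < e" for e
      using that by simp
    moreover have "((\<lambda>e. Lam p m ^ CARD('n) * (A + e)) \<longlongrightarrow> Lam p m ^ CARD('n) * (A + 0)) (at_right 0)"
      by (intro tendsto_intros)
    ultimately have "Lp_norm p torus (cpoly_eval P) \<le> Lam p m ^ CARD('n) * (A + 0)"
      by (intro tendsto_lowerbound) (auto intro!: eventually_at_rightI[of 0 1])
    then show ?thesis
      using A0 unfolding True N_E N_T by (simp add: rpow_def C_const_1)
  qed
qed (auto simp: C_const_le_2 C_const_1)

end
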